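(* Let $\mathcal{J}:\mathbb{R}^n\to\mathbb{R}\cup\{\infty\}$ be coercive, proper, lower semi-continuous, and continuous on its domain $\operatorname{dom}\mathcal{J}$. Let $V_1,\dots,V_m\subset\mathbb{R}^n$ be linear subspaces with $\mathbb{R}^n=\sum_{k=1}^m V_k$ (the sum need not be direct), and assume that for each $w\in\operatorname{dom}\mathcal{J}$ and each $k=1,\dots,m$ the function $V_k\ni v\mapsto\mathcal{J}(w+v)$ has a unique global minimizer. For $k=1,\dots,m$ let $\mathcal{M}_k:\operatorname{dom}\mathcal{J}\to\operatorname{dom}\mathcal{J}$ be maps with $\mathcal{M}_k(w)-w\in V_k$ for all $w\in\operatorname{dom}\mathcal{J}$, let $\mathcal{C}:\operatorname{dom}\mathcal{J}\to\operatorname{dom}\mathcal{J}$ be a map, let $u^0\in\operatorname{dom}\mathcal{J}$, and define $(u^\nu)_{\nu\ge 0}$ by $$u^{\nu+\frac12}=(\mathcal{M}_m\circ\dots\circ\mathcal{M}_1)(u^\nu),\qquad u^{\nu+1}=\mathcal{C}(u^{\nu+\frac12}).$$ Assume that there are maps $\tilde{\mathcal{M}}_k:\operatorname{dom}\mathcal{J}\to\operatorname{dom}\mathcal{J}$, $k=1,\dots,m$, with $\tilde{\mathcal{M}}_k(w)-w\in V_k$ for all $w\in\operatorname{dom}\mathcal{J}$, such that for every $k$: 1. (Monotonicity) $\mathcal{J}(\mathcal{M}_k(v))\le\mathcal{J}(\tilde{\mathcal{M}}_k(v))\le\mathcal{J}(v)$ and $\mathcal{J}(\mathcal{C}(v))\le\mathcal{J}(v)$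 for all $v\in\operatorname{dom}\mathcal{J}$; 2. (Continuity) $\mathcal{J}\circ\tilde{\mathcal{M}}_k$ is continuous on $\operatorname{dom}\mathcal{J}$; 3. (Stability) $\mathcal{J}(\tilde{\mathcal{M}}_k(v))<\mathcal{J}(v)$ for every $v\in\operatorname{dom}\mathcal{J}$ such that $\mathcal{J}(v)$ is not minimal in $v+V_k$. Then any accumulation point $u$ of $(u^\nu)$ is stationary in the sense that $$\mathcal{J}(u)\le\mathcal{J}(u+v)\qquad\forall v\in V_k,\quad k=1,\dots,m.$$
   Context: $\operatorname{dom}\mathcal{J}=\{x\in\mathbb{R}^n : \mathcal{J}(x)<\infty\}$, with the topology induced from $\mathbb{R}^n$. Coercive means $\mathcal{J}(v)\to\infty$ as $\|v\|\to\infty$. "$\mathcal{J}$ is continuous on its domain" means that the restriction of $\mathcal{J}$ to $\operatorname{dom}\mathcal{J}$ is continuous. *)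

theory Defs
  imports "HOL-Analysis.Analysis"
begin

text \<open>Functionals with values in \<open>\<real> \<union> {\<infinity>}\<close> are rendered as \<^typ>\<open>ereal\<close>-valued
  functions that never take the value \<open>-\<infinity>\<close>; that restriction is a hypothesis of its own
  and is not part of the notions below.\<close>

definition effective_domain :: "('a \<Rightarrow> ereal) \<Rightarrow> 'a set" where
  "effective_domain J = {x. J x < \<infinity>}"

definition proper_functional :: "('a \<Rightarrow> ereal) \<Rightarrow> bool" where
  "proper_functional J \<longleftrightarrow> effective_domain J \<noteq> {}"

text \<open>\<^const>\<open>at_infinity\<close> is the filter of \<open>norm x \<rightarrow> \<infinity>\<close>.\<close>

definition coercive :: "('a::real_normed_vector \<Rightarrow> ereal) \<Rightarrow> bool" where
  "coercive J \<longleftrightarrow> (J \<longlongrightarrow> \<infinity>) at_infinity"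

definition lower_semicontinuous :: "('a::topological_space \<Rightarrow> ereal) \<Rightarrow> bool" where
  "lower_semicontinuous J \<longleftrightarrow> (\<forall>x. J x \<le> Liminf (at x) J)"

text \<open>Accumulation points of a sequence (limits of subsequences), not limit points of its range:
  a sequence that is eventually constant has its final value as an accumulation point.\<close>

definition seq_accumulation_point :: "(nat \<Rightarrow> 'a::topological_space) \<Rightarrow> 'a \<Rightarrow> bool" where
  "seq_accumulation_point u x \<longleftrightarrow> (\<exists>r. strict_mono r \<and> (u \<circ> r) \<longlonglongrightarrow> x)"

text \<open>The composition \<open>M m \<circ> \<dots> \<circ> M 1\<close>; \<^const>\<open>fold\<close> applies \<open>M 1\<close> first.\<close>

definition sweep :: "(nat \<Rightarrow> 'a \<Rightarrow> 'a) \<Rightarrow> nat \<Rightarrow> 'a \<Rightarrow> 'a" where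
  "sweep M m = fold M [1..<Suc m]"

end

theory Submission
  imports Defs
begin

text \<open>By monotonicity and compactness of the sublevel sets of \<open>J\<close>, the energies of all
  intermediate iterates along a convergent subsequence tend to \<open>J u\<close>. If the iterates before
  the \<open>k\<close>-th correction tend to \<open>u\<close>, then continuity of \<open>J \<circ> Mt k\<close> forces \<open>J (Mt k u) = J u\<close>, so
  \<open>u\<close> is minimal in \<open>u + V k\<close> by stability. A limit of the iterates after the correction lies in
  \<open>u + V k\<close> and has the same energy, so it is \<open>u\<close> again by uniqueness of the minimizer, and the
  argument passes on to \<open>k + 1\<close>.\<close>

text \<open>If \<open>J x\<close> exceeds \<open>c\<close>, then so does the lower limit of
  \<open>J\<close> at \<open>x\<close>, hence \<open>J\<close> exceeds \<open>c\<close> on a whole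
  neighbourhood of \<open>x\<close>; the complement is therefore open.\<close>

lemma closed_sublevel:
  assumes "lower_semicontinuous J"
  shows "closed {x. J x \<le> c}"
proof -
  have "\<exists>T. open T \<and> x \<in> T \<and> T \<subseteq> - {x. J x \<le> c}" if "\<not> J x \<le> c" for x
  proof -
    have "c < Liminf (at x) J"
      using assms that unfolding lower_semicontinuous_def by (meson less_le_trans not_le)
    then have "eventually (\<lambda>y. c < J y) (at x)"
      by (rule less_LiminfD)
    \<comment> \<open>The filter \<open>at x\<close> omits \<open>x\<close> itself; the assumption
      on \<open>J x\<close> fills the gap.\<close>
    then have "eventually (\<lambda>y. c < J y) (nhds x)"
      using that by (simp add: eventually_nhds_conv_at not_le)
    then obtain T where T: "open T" "x \<in> T" "\<forall>y\<in>T. c < J y"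
      unfolding eventually_nhds by blast
    then have "T \<subseteq> - {x. J x \<le> c}"
      by (auto dest: leD)
    with T show ?thesis
      by blast
  qed
  then have "open (- {x. J x \<le> c})"
    by (subst open_subopen) simp
  then show ?thesis
    by (simp add: closed_def)
qed

text \<open>Coercivity gives boundedness and lower semicontinuity gives closedness, so Heine-Borel
  applies.\<close>

lemma compact_sublevel:
  fixes J :: "'a::euclidean_space \<Rightarrow> ereal"
  assumes "coercive J" "lower_semicontinuous J" "c < \<infinity>"
  shows "compact {x. J x \<le> c}"
proof -
  have "eventually (\<lambda>x. c < J x) at_infinity"
    using assms by (auto simp: coercive_def intro: order_tendstoD)
  then obtain b where "\<And>x. norm x \<ge> b \<Longrightarrow> c < J x"
    by (auto simp: eventually_at_infinity)
  then have "\<forall>x\<in>{x. J x \<le> c}. norm x \<le> b"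
    by (metis mem_Collect_eq linear not_le)
  then have "bounded {x. J x \<le> c}"
    unfolding bounded_iff by blast
  then show ?thesis
    using closed_sublevel[OF assms(2)] by (simp add: compact_eq_bounded_closed)
qed

text \<open>One subspace correction for abstract sequences: \<open>x\<close> and \<open>y\<close>
  are the iterates before and after it, and \<open>T\<close> is the comparison map. The correction
  itself may be discontinuous, so it enters only through \<open>y\<close> and the squeeze
  \<open>J u\<close> \<le> \<open>J (y n)\<close> \<le> \<open>J (T (x n))\<close>, whose upper
  bound converges to \<open>J (T u)\<close>.\<close>

lemma relaxation_step:
  fixes J :: "'a::euclidean_space \<Rightarrow> ereal"
  assumes compact: "compact {x. J x \<le> c}" and "c < \<infinity>"
    and J_cont: "continuous_on (effective_domain J) J"
    and V: "subspace V"
    and unique: "\<exists>!v. is_arg_min (\<lambda>v. J (u + v)) (\<lambda>v. v \<in> V) v"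
    and T_cont: "continuous_on (effective_domain J) (J \<circ> T)"
    and T_le: "J (T u) \<le> J u"
    and stable: "\<not> (\<forall>z\<in>V. J u \<le> J (u + z)) \<longrightarrow> J (T u) < J u"
    and u: "u \<in> effective_domain J"
    and x: "\<And>n. x n \<in> effective_domain J" "x \<longlonglongrightarrow> u"
    and y: "\<And>n. y n - x n \<in> V" "\<And>n. J (y n) \<le> c"
      "\<And>n. J u \<le> J (y n)" "\<And>n. J (y n) \<le> J (T (x n))"
  shows "(\<forall>z\<in>V. J u \<le> J (u + z)) \<and> (\<exists>s. strict_mono s \<and> (y \<circ> s) \<longlonglongrightarrow> u)"
proof -
  have JT: "(\<lambda>n. J (T (x n))) \<longlonglongrightarrow> J (T u)"
    using continuous_on_tendsto_compose[OF T_cont x(2) u] x(1) by simp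
  \<comment> \<open>\<open>J u\<close> bounds every \<open>J (T (x n))\<close> from below, hence
    also their limit. This excludes the strict decrease that stability would give at a non-minimal
    \<open>u\<close>.\<close>
  have "J u \<le> J (T u)"
    using y(3,4) by (intro LIMSEQ_le_const[OF JT]) (meson order_trans)
  with stable have min: "\<forall>z\<in>V. J u \<le> J (u + z)"
    by (auto simp: not_less[symmetric])
  obtain w s where w: "J w \<le> c" and s: "strict_mono s" and ys: "(y \<circ> s) \<longlonglongrightarrow> w"
    using compact y(2) unfolding compact_def by (metis mem_Collect_eq)
  have xs: "(x \<circ> s) \<longlonglongrightarrow> u"
    using x(2) s by (rule LIMSEQ_subseq_LIMSEQ)
  \<comment> \<open>The differences \<open>y n - x n\<close> lie in \<open>V\<close>, which is
    closed as a subspace of a finite-dimensional space.\<close>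
  have "w - u \<in> V"
    using closed_sequentially[OF closed_subspace[OF V] _ tendsto_diff[OF ys xs]] y(1) by simp
  have "w \<in> effective_domain J" "\<And>n. y n \<in> effective_domain J"
    using le_less_trans[OF w \<open>c < \<infinity>\<close>] le_less_trans[OF y(2) \<open>c < \<infinity>\<close>]
    by (simp_all only: effective_domain_def mem_Collect_eq)
  \<comment> \<open>Continuity of \<open>J\<close> is available only on the domain; the finite bound
    \<open>c\<close> keeps both the sequence and its limit there.\<close>
  then have Jy: "(\<lambda>n. J ((y \<circ> s) n)) \<longlonglongrightarrow> J w"
    using continuous_on_tendsto_compose[OF J_cont ys] by simp
  have "J w \<le> J (T u)"
    using LIMSEQ_le[OF Jy LIMSEQ_subseq_LIMSEQ[OF JT s]] y(4) by simp
  with T_le have "J w \<le> J u"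
    by simp
  \<comment> \<open>Both \<open>w - u\<close> and \<open>0\<close> minimize \<open>J (u + v)\<close>
    over \<open>V\<close>, so they coincide.\<close>
  with min \<open>w - u \<in> V\<close>
  have "is_arg_min (\<lambda>v. J (u + v)) (\<lambda>v. v \<in> V) (w - u)"
    by (fastforce simp: is_arg_min_def not_less)
  moreover have "is_arg_min (\<lambda>v. J (u + v)) (\<lambda>v. v \<in> V) 0"
    using min subspace_0[OF V] by (auto simp: is_arg_min_def not_less)
  ultimately have "w = u"
    using unique by (metis eq_iff_diff_eq_0)
  with min s ys show ?thesis
    by blast
qed

lemma sweep_0 [simp]: "sweep M 0 x = x"
  by (simp add: sweep_def)

lemma sweep_Suc [simp]: "sweep M (Suc k) x = M (Suc k) (sweep M k x)"
  by (simp add: sweep_def)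

lemma sweep_in:
  assumes "\<forall>k\<in>{1..m}. M k \<in> D \<rightarrow> D" "x \<in> D" "k \<le> m"
  shows "sweep M k x \<in> D"
  using assms(3)
proof (induction k)
  case (Suc k)
  then have "M (Suc k) \<in> D \<rightarrow> D" "sweep M k x \<in> D"
    using assms(1) by auto
  then show ?case
    by auto
qed (use assms in simp)

lemma sweep_antimono:
  fixes f :: "'a \<Rightarrow> 'b::preorder"
  assumes "\<forall>k\<in>{1..m}. M k \<in> D \<rightarrow> D" "x \<in> D"
    and le: "\<And>k v. k \<in> {1..m} \<Longrightarrow> v \<in> D \<Longrightarrow> f (M k v) \<le> f v"
    and "i \<le> j" "j \<le> m"
  shows "f (sweep M j x) \<le> f (sweep M i x)"
  using assms(4,5)
proof (induction j rule: dec_induct)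
  case (step j)
  have "f (M (Suc j) (sweep M j x)) \<le> f (sweep M j x)"
    using step.prems by (intro le sweep_in[OF assms(1,2)]) auto
  with step show ?case
    using order_trans by fastforce
qed simp

theorem theorem4p1:
  fixes J :: "real ^ 'n \<Rightarrow> ereal"
    and V :: "nat \<Rightarrow> (real ^ 'n) set"
    and m :: nat
    and M Mt :: "nat \<Rightarrow> real ^ 'n \<Rightarrow> real ^ 'n"
    and C :: "real ^ 'n \<Rightarrow> real ^ 'n"
    and u uhalf :: "nat \<Rightarrow> real ^ 'n"
    and ustar :: "real ^ 'n"
  assumes J_range: "\<forall>x. J x \<noteq> -\<infinity>"
    and J_coercive: "coercive J"
    and J_proper: "proper_functional J"
    and J_lsc: "lower_semicontinuous J"
    and J_cont: "continuous_on (effective_domain J) J"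
    and V_subspace: "\<forall>k\<in>{1..m}. subspace (V k)"
    and V_sum: "(UNIV :: (real ^ 'n) set) = {\<Sum>k=1..m. x k | x. \<forall>k\<in>{1..m}. x k \<in> V k}"
    and unique_min: "\<forall>w\<in>effective_domain J. \<forall>k\<in>{1..m}.
          \<exists>!v. is_arg_min (\<lambda>v. J (w + v)) (\<lambda>v. v \<in> V k) v"
    and M_maps: "\<forall>k\<in>{1..m}. M k \<in> effective_domain J \<rightarrow> effective_domain J"
    and M_diff: "\<forall>k\<in>{1..m}. \<forall>w\<in>effective_domain J. M k w - w \<in> V k"
    and C_maps: "C \<in> effective_domain J \<rightarrow> effective_domain J"
    and u_0: "u 0 \<in> effective_domain J"
    and u_half: "\<forall>\<nu>. uhalf \<nu> = sweep M m (u \<nu>)"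
    and u_Suc: "\<forall>\<nu>. u (Suc \<nu>) = C (uhalf \<nu>)"
    and Mt_maps: "\<forall>k\<in>{1..m}. Mt k \<in> effective_domain J \<rightarrow> effective_domain J"
    and Mt_diff: "\<forall>k\<in>{1..m}. \<forall>w\<in>effective_domain J. Mt k w - w \<in> V k"
    and monotonicity: "\<forall>k\<in>{1..m}. \<forall>v\<in>effective_domain J. J (M k v) \<le> J (Mt k v) \<and> J (Mt k v) \<le> J v"
    and C_monotonicity: "\<forall>v\<in>effective_domain J. J (C v) \<le> J v"
    and continuity: "\<forall>k\<in>{1..m}. continuous_on (effective_domain J) (J \<circ> Mt k)"
    and stability: "\<forall>k\<in>{1..m}. \<forall>v\<in>effective_domain J.
          \<not> (\<forall>z\<in>V k. J v \<le> J (v + z)) \<longrightarrow> J (Mt k v) < J v"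
    and accumulation: "seq_accumulation_point u ustar"
  shows "\<forall>k\<in>{1..m}. \<forall>v\<in>V k. J ustar \<le> J (ustar + v)"
proof -
  let ?D = "effective_domain J"
  define c where "c = J (u 0)"
  have c: "c < \<infinity>"
    using u_0 by (simp add: c_def effective_domain_def)
  have M_le: "J (M k v) \<le> J v" if "k \<in> {1..m}" "v \<in> ?D" for k v
    using monotonicity that order_trans by blast
  have sweep_dom: "sweep M k v \<in> ?D" if "v \<in> ?D" "k \<le> m" for k v
    using sweep_in[OF M_maps] that by blast
  have u_eq: "u (Suc n) = C (sweep M m (u n))" for n
    by (simp add: u_Suc u_half)
  have u_dom: "u n \<in> ?D" for n
    by (induction n) (use u_0 C_maps sweep_dom u_eq in auto)
  have Suc_le: "J (u (Suc n)) \<le> J (sweep M k (u n))" if "k \<le> m" for n k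
  proof -
    have "J (u (Suc n)) \<le> J (sweep M m (u n))"
      using C_monotonicity sweep_dom[OF u_dom order_refl] by (simp add: u_eq)
    also have "\<dots> \<le> J (sweep M k (u n))"
      using that by (intro sweep_antimono[where f = J, OF M_maps u_dom] M_le) auto
    finally show ?thesis .
  qed
  have le_u: "J (sweep M k (u n)) \<le> J (u n)" if "k \<le> m" for n k
    using sweep_antimono[where f = J and i = 0, OF M_maps u_dom M_le _ that] by simp
  \<comment> \<open>With \<open>k = 0\<close> the partial sweep is the identity, so
    \<open>Suc_le\<close> compares consecutive iterates.\<close>
  have dec: "decseq (\<lambda>n. J (u n))"
    using Suc_le[of 0] by (simp add: decseq_Suc_iff)
  have le_c: "J (u n) \<le> c" for n
    using decseqD[OF dec, of 0 n] by (simp add: c_def)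
  obtain r where r: "strict_mono r" "(u \<circ> r) \<longlonglongrightarrow> ustar"
    using accumulation by (auto simp: seq_accumulation_point_def)
  \<comment> \<open>The domain of \<open>J\<close> need not be closed, so the limit is caught in a
    closed sublevel set inside it.\<close>
  have "ustar \<in> {x. J x \<le> c}"
    using closed_sequentially[OF closed_sublevel[OF J_lsc] _ r(2)] le_c by auto
  with c have ustar: "ustar \<in> ?D"
    unfolding effective_domain_def by (blast intro: le_less_trans)
  have lim: "(\<lambda>n. J ((u \<circ> r) n)) \<longlonglongrightarrow> J ustar"
    using continuous_on_tendsto_compose[OF J_cont r(2) ustar] u_dom by simp
  \<comment> \<open>The energies decrease along the full sequence, so the limit along
    \<open>r\<close> bounds all of them from below.\<close>
  have ustar_le: "J ustar \<le> J (u n)" for n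
  proof (rule LIMSEQ_le_const2[OF lim], intro exI allI impI)
    fix i assume "n \<le> i"
    then have "n \<le> r i"
      using seq_suble[OF r(1), of i] by simp
    then show "J ((u \<circ> r) i) \<le> J (u n)"
      using decseqD[OF dec] by simp
  qed
  \<comment> \<open>The index map \<open>q\<close> may be arbitrary: the bounds
    \<open>J ustar\<close> and \<open>c\<close> hold at every index, so only convergence along
    \<open>q\<close> matters.\<close>
  have step: "(\<forall>z\<in>V (Suc k). J ustar \<le> J (ustar + z)) \<and>
      (\<exists>s. strict_mono s \<and> ((\<lambda>n. sweep M (Suc k) (u (q n))) \<circ> s) \<longlonglongrightarrow> ustar)"
    if "Suc k \<le> m" and q: "(\<lambda>n. sweep M k (u (q n))) \<longlonglongrightarrow> ustar" for k q
  proof (rule relaxation_step[OF compact_sublevel[OF J_coercive J_lsc c] c J_cont,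
        where T = "Mt (Suc k)" and x = "\<lambda>n. sweep M k (u (q n))"])
    have k: "Suc k \<in> {1..m}"
      using that by simp
    have dom: "sweep M k (u (q n)) \<in> ?D" for n
      using that by (intro sweep_dom u_dom) simp
    show "sweep M k (u (q n)) \<in> ?D" for n
      by (rule dom)
    show "sweep M (Suc k) (u (q n)) - sweep M k (u (q n)) \<in> V (Suc k)" for n
      using M_diff k dom by simp
    show "J (sweep M (Suc k) (u (q n))) \<le> c" for n
      using le_u[OF that(1)] le_c by (rule order_trans)
    show "J ustar \<le> J (sweep M (Suc k) (u (q n)))" for n
      using ustar_le Suc_le[OF that(1)] by (rule order_trans)
    show "J (sweep M (Suc k) (u (q n))) \<le> J (Mt (Suc k) (sweep M k (u (q n))))" for n
      using monotonicity k dom by simp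
  qed (use that V_subspace unique_min continuity monotonicity stability ustar in auto)
  have conv: "\<exists>q. (\<lambda>n. sweep M k (u (q n))) \<longlonglongrightarrow> ustar" if "k \<le> m" for k
    using that
  proof (induction k)
    case 0
    show ?case
      using r(2) by (auto simp: o_def)
  next
    case (Suc k)
    then obtain q where "(\<lambda>n. sweep M k (u (q n))) \<longlonglongrightarrow> ustar"
      by auto
    from step[OF Suc.prems this]
    \<comment> \<open>Each correction may require a further subsequence, so the index map is refined
      to \<open>q \<circ> s\<close>.\<close>
    obtain s where "(\<lambda>n. sweep M (Suc k) (u ((q \<circ> s) n))) \<longlonglongrightarrow> ustar"
      by (auto simp: o_def)
    then show ?case
      by blast
  qed
  show ?thesis
  proof
    fix k assume "k \<in> {1..m}"
    \<comment> \<open>Corrections are numbered from 1; minimality over \<open>V (Suc j)\<close> uses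
      the iterates after \<open>j\<close> corrections.\<close>
    then obtain j where j: "k = Suc j" "Suc j \<le> m"
      by (cases k) auto
    then show "\<forall>v\<in>V k. J ustar \<le> J (ustar + v)"
      using conv[of j] step by (metis Suc_leD)
  qed
qed

end
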